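(* Let $L$ be a language on a finite alphabet satisfying a symmetric order condition. Then $L$ is rich, i.e. every full return word in $L$ to a palindrome is a palindrome.
   Context: A language is a set of finite words containing the empty word, closed under taking factors and extendable (each $v\in L$ has letters $a,b$ with $av,vb\in L$). A word $v\in L$ is bispecial if at least two letters $x$ have $xv\in L$ and at least two letters $y$ have $vy\in L$. For strict total orders $(<_A,<_D)$ on the alphabet, a bispecial $v$ satisfies the order condition if whenever $xvy,x'vy'\in L$ with letters $x\ne x'$, $y\ne y'$, then $x<_Ax'$ iff $y<_Dy'$; $L$ satisfies the order condition if all its bispecial words (including the empty word) do; the order condition is symmetric if $<_D$ is the reverse of $<_A$. A palindrome is a word equal to its reverse. A full return word to a word $w$ is a word of $L$ that has exactly two occurrences of $w$, one as a prefix and one as a suffix. *)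

theory Defs
  imports "HOL-Library.Sublist"
begin

definition language :: "'a set \<Rightarrow> 'a list set \<Rightarrow> bool" where
  "language A L \<longleftrightarrow>
     L \<subseteq> lists A \<and> [] \<in> L \<and>
     (\<forall>v\<in>L. \<forall>u. sublist u v \<longrightarrow> u \<in> L) \<and>
     (\<forall>v\<in>L. (\<exists>a. a # v \<in> L) \<and> (\<exists>b. v @ [b] \<in> L))"

definition bispecial :: "'a list set \<Rightarrow> 'a list \<Rightarrow> bool" where
  "bispecial L v \<longleftrightarrow>
     v \<in> L \<and>
     (\<exists>x x'. x \<noteq> x' \<and> x # v \<in> L \<and> x' # v \<in> L) \<and>
     (\<exists>y y'. y \<noteq> y' \<and> v @ [y] \<in> L \<and> v @ [y'] \<in> L)"

definition strict_total_order_on :: "'a set \<Rightarrow> 'a rel \<Rightarrow> bool" where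
  "strict_total_order_on A r \<longleftrightarrow> r \<subseteq> A \<times> A \<and> strict_linear_order_on A r"

definition word_order_condition :: "'a list set \<Rightarrow> 'a rel \<Rightarrow> 'a rel \<Rightarrow> 'a list \<Rightarrow> bool" where
  "word_order_condition L rA rD v \<longleftrightarrow>
     (\<forall>x x' y y'. x # v @ [y] \<in> L \<and> x' # v @ [y'] \<in> L \<and> x \<noteq> x' \<and> y \<noteq> y' \<longrightarrow>
        ((x, x') \<in> rA \<longleftrightarrow> (y, y') \<in> rD))"

definition order_condition :: "'a set \<Rightarrow> 'a list set \<Rightarrow> 'a rel \<Rightarrow> 'a rel \<Rightarrow> bool" where
  "order_condition A L rA rD \<longleftrightarrow>
     strict_total_order_on A rA \<and> strict_total_order_on A rD \<and>
     (\<forall>v. bispecial L v \<longrightarrow> word_order_condition L rA rD v)"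

definition symmetric_order_condition :: "'a set \<Rightarrow> 'a list set \<Rightarrow> 'a rel \<Rightarrow> 'a rel \<Rightarrow> bool" where
  "symmetric_order_condition A L rA rD \<longleftrightarrow> order_condition A L rA rD \<and> rD = rA\<inverse>"

definition palindrome :: "'a list \<Rightarrow> bool" where
  "palindrome w \<longleftrightarrow> rev w = w"

definition occurrences :: "'a list \<Rightarrow> 'a list \<Rightarrow> nat set" where
  "occurrences w v = {i. \<exists>p s. v = p @ w @ s \<and> length p = i}"

definition full_return_word :: "'a list set \<Rightarrow> 'a list \<Rightarrow> 'a list \<Rightarrow> bool" where
  "full_return_word L w v \<longleftrightarrow>
     v \<in> L \<and> card (occurrences w v) = 2 \<and> prefix w v \<and> suffix w v"

definition rich :: "'a list set \<Rightarrow> bool" where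
  "rich L \<longleftrightarrow> (\<forall>w v. palindrome w \<and> full_return_word L w v \<longrightarrow> palindrome v)"

end

theory Submission
  imports Defs
begin

text \<open>
  For a symmetric order the condition says that \<open>x < x'\<close> iff \<open>y' < y\<close> whenever \<open>xuy\<close> and \<open>x'uy'\<close>
  occur with \<open>x \<noteq> x'\<close> and \<open>y \<noteq> y'\<close>. The argument is an induction on the length of a single word
  with this property, by recoding it over the gaps between the occurrences of a letter \<open>c\<close>, ordered
  lexicographically. If all gaps are palindromes, the recoded word has the property again.

  For a full return word to a letter \<open>x\<close>, the condition on pairs of letters forces the form
  \<open>xa\<dots>ax\<close>; the gaps between the \<open>a\<close>'s are palindromes by induction, and the word recoded by these
  gaps is a shorter full return word to the letter \<open>[x]\<close>. Hence gaps are always palindromes. A full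
  return word to a longer palindrome \<open>w = c\<dots>c\<close> is recoded by the gaps between the \<open>c\<close>'s into a
  shorter full return word to the recoded \<open>w\<close>, which is again a palindrome.
\<close>

section \<open>Order-reversing words\<close>

text \<open>The symmetric order condition is put on a single finite word, because recoding such a
  word yields another finite word and not an extendable language.\<close>

definition order_reversing :: "'a rel \<Rightarrow> 'a list \<Rightarrow> bool" where
  "order_reversing r v \<longleftrightarrow>
     (\<forall>x x' y y' u. sublist (x # u @ [y]) v \<and> sublist (x' # u @ [y']) v \<and> x \<noteq> x' \<and> y \<noteq> y' \<longrightarrow>
        ((x, x') \<in> r \<longleftrightarrow> (y', y) \<in> r))"

lemma order_reversingD:
  assumes "order_reversing r v" "sublist (x # u @ [y]) v" "sublist (x' # u @ [y']) v"
    "x \<noteq> x'" "y \<noteq> y'"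
  shows "(x, x') \<in> r \<longleftrightarrow> (y', y) \<in> r"
  using assms unfolding order_reversing_def by blast

lemma order_reversing_sublist:
  "order_reversing r v \<Longrightarrow> sublist u v \<Longrightarrow> order_reversing r u"
  unfolding order_reversing_def using sublist_order.order_trans[of _ u v] by blast

text \<open>Reversal exchanges the letters on the left and on the right of the middle word. Since
  the right-hand order is the converse of the left-hand one, the condition is invariant under this
  exchange.\<close>

lemma order_reversing_rev:
  assumes "order_reversing r v"
  shows "order_reversing r (rev v)"
  unfolding order_reversing_def
proof (intro allI impI, elim conjE)
  fix x x' y y' u
  assume *: "sublist (x # u @ [y]) (rev v)" "sublist (x' # u @ [y']) (rev v)" "x \<noteq> x'" "y \<noteq> y'"
  have "sublist (y' # rev u @ [x']) v" "sublist (y # rev u @ [x]) v"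
    using *(1,2) by (simp_all add: sublist_rev_right)
  from order_reversingD[OF assms this] *(3,4)
  show "(x, x') \<in> r \<longleftrightarrow> (y', y) \<in> r" by auto
qed

lemma map_eq_append3E:
  assumes "map f v = p @ w @ s"
  obtains p' w' s' where "v = p' @ w' @ s'" "p = map f p'" "w = map f w'" "s = map f s'"
  using assms by (auto simp: map_eq_append_conv append_eq_map_conv)

lemma sublist_map_right:
  assumes "sublist xs (map f ys)"
  obtains zs where "sublist zs ys" "xs = map f zs"
proof -
  obtain p s where "map f ys = p @ xs @ s" using assms by (auto simp: sublist_def)
  then obtain p' z s' where "ys = p' @ z @ s'" "xs = map f z"
    by (elim map_eq_append3E)
  then show ?thesis using that by (auto simp: sublist_def)
qed

text \<open>Injectivity on the letters makes equal middle words in the image come from equal middle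
  words in \<open>v\<close>, so every comparison in the image is already one in
  \<open>v\<close>.\<close>

lemma order_reversing_map:
  assumes v: "order_reversing r v"
    and inj: "inj_on f (set v)"
    and mono: "\<And>x y. x \<in> set v \<Longrightarrow> y \<in> set v \<Longrightarrow> (f x, f y) \<in> r' \<longleftrightarrow> (x, y) \<in> r"
  shows "order_reversing r' (map f v)"
  unfolding order_reversing_def
proof (intro allI impI, elim conjE)
  fix x x' y y' u
  assume *: "sublist (x # u @ [y]) (map f v)" "sublist (x' # u @ [y']) (map f v)" "x \<noteq> x'" "y \<noteq> y'"
  obtain a s b where 1: "sublist (a # s @ [b]) v" "x = f a" "u = map f s" "y = f b"
    using *(1) by (elim sublist_map_right) (auto simp: Cons_eq_map_conv append_eq_map_conv)
  obtain a' s' b' where 2: "sublist (a' # s' @ [b']) v" "x' = f a'" "u = map f s'" "y' = f b'"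
    using *(2) by (elim sublist_map_right) (auto simp: Cons_eq_map_conv append_eq_map_conv)
  have sub: "set (a # s @ [b]) \<subseteq> set v" "set (a' # s' @ [b']) \<subseteq> set v"
    using set_mono_sublist 1(1) 2(1) by blast+
  have "inj_on f (set s \<union> set s')" using sub by (intro inj_on_subset[OF inj]) auto
  then have "s' = s" using 1(3) 2(3) map_inj_on[of f s s'] by (auto simp: Un_commute)
  moreover have "a \<noteq> a'" "b \<noteq> b'" using * 1 2 by auto
  ultimately have "(a, a') \<in> r \<longleftrightarrow> (b', b) \<in> r"
    using order_reversingD[OF v 1(1), of a' b'] 2(1) by simp
  then show "(x, x') \<in> r' \<longleftrightarrow> (y', y) \<in> r'"
    using mono sub 1 2 by simp
qed

section \<open>Coding of letters by integers\<close>

abbreviation int_less :: "int rel" where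
  "int_less \<equiv> {(i, j). i < j}"

text \<open>Recoding changes the type of letters, so the inductions are carried out over integers.\<close>

lemma order_reversing_int_code:
  assumes "finite S" "set v \<subseteq> S" "strict_linear_order_on S r" "order_reversing r v"
  obtains f :: "'a \<Rightarrow> int" where "inj_on f S" "order_reversing int_less (map f v)"
proof -
  \<comment> \<open>The rank of a letter embeds the finite order into the integers.\<close>
  define f where "f a = int (card {b \<in> S. (b, a) \<in> r})" for a
  have tr: "trans r" and irr: "irrefl r" and tot: "total_on S r"
    using assms(3) by (auto simp: strict_linear_order_on_def)
  have less: "f a < f b" if "a \<in> S" "b \<in> S" "(a, b) \<in> r" for a b
  proof -
    have "{c \<in> S. (c, a) \<in> r} \<subset> {c \<in> S. (c, b) \<in> r}"
      using that tr irr by (auto simp: irrefl_def dest: transD)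
    then show ?thesis unfolding f_def using assms(1) by (simp add: psubset_card_mono)
  qed
  have iff: "f a < f b \<longleftrightarrow> (a, b) \<in> r" if "a \<in> S" "b \<in> S" for a b
    using less[of a b] less[of b a] that tot by (fastforce simp: total_on_def)
  have inj: "inj_on f S"
    using less tot by (intro inj_onI) (metis less_irrefl total_on_def)
  have "order_reversing int_less (map f v)"
    using assms(2) iff by (intro order_reversing_map[OF assms(4)] inj_on_subset[OF inj]) auto
  with inj show ?thesis by (rule that)
qed

section \<open>Cutting a word at the occurrences of a letter\<close>

text \<open>This undoes the recoding over gaps. Both ends carry a \<open>c\<close>, so that every
  gap is bounded on both sides; adjacent parts of a word therefore share one
  \<open>c\<close>.\<close>

fun separated :: "'a \<Rightarrow> 'a list list \<Rightarrow> 'a list" where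
  "separated c [] = [c]"
| "separated c (g # gs) = c # g @ separated c gs"

lemma separated_eq_Cons: "separated c gs = c # tl (separated c gs)"
  by (cases gs) auto

lemma separated_not_Nil [simp]: "separated c gs \<noteq> []"
  by (cases gs) auto

lemma separated_append: "separated c (gs @ hs) = separated c gs @ tl (separated c hs)"
  by (induction gs) (auto simp: separated_eq_Cons[symmetric])

lemma separated_append': "separated c (gs @ hs) = butlast (separated c gs) @ separated c hs"
  by (induction gs) (auto simp: butlast_append)

lemma length_separated: "length gs < length (separated c gs)"
  by (induction gs) auto

lemma rev_separated: "rev (separated c gs) = separated c (rev (map rev gs))"
  by (induction gs) (auto simp: separated_append)

lemma separated_palindrome:
  assumes "\<forall>g \<in> set gs. rev g = g" "rev gs = gs"
  shows "rev (separated c gs) = separated c gs"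
proof -
  have "map rev gs = gs" using assms(1) by (simp add: map_idI)
  then show ?thesis using assms(2) by (simp add: rev_separated)
qed

text \<open>A gap avoids \<open>c\<close>, so it is the longest \<open>c\<close>-free piece after
  the leading \<open>c\<close>, and \<open>takeWhile\<close> recovers it.\<close>

lemma separated_inj:
  assumes "\<forall>g \<in> set gs. c \<notin> set g" "\<forall>g \<in> set hs. c \<notin> set g" "separated c gs = separated c hs"
  shows "gs = hs"
  using assms
proof (induction gs arbitrary: hs)
  case Nil
  then show ?case by (cases hs) auto
next
  case (Cons g gs)
  obtain h hs' where hs: "hs = h # hs'"
    using Cons.prems(3) by (cases hs) auto
  have eq: "g @ separated c gs = h @ separated c hs'" using Cons.prems(3) hs by simp
  have "takeWhile (\<lambda>z. z \<noteq> c) (g @ separated c gs) = g"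
    using Cons.prems(1) by (subst separated_eq_Cons) (auto simp: takeWhile_append)
  moreover have "takeWhile (\<lambda>z. z \<noteq> c) (h @ separated c hs') = h"
    using Cons.prems(2) hs by (subst separated_eq_Cons) (auto simp: takeWhile_append)
  ultimately have "g = h" using eq by simp
  moreover have "gs = hs'" using Cons.prems(1,2) eq hs \<open>g = h\<close> by (intro Cons.IH) simp_all
  ultimately show ?case using hs by simp
qed

lemma separated_exists:
  assumes "v \<noteq> []" "hd v = c" "last v = c"
  obtains gs where "\<forall>g \<in> set gs. c \<notin> set g" "v = separated c gs"
proof -
  have "\<exists>gs. (\<forall>g \<in> set gs. c \<notin> set g) \<and> v = separated c gs"
    using assms
  proof (induction "length v" arbitrary: v rule: less_induct)
    case less
    then obtain v' where v: "v = c # v'" by (cases v) auto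
    show ?case
    proof (cases "v' = []")
      case True
      then show ?thesis using v by (intro exI[of _ "[]"]) auto
    next
      case False
      then have "c \<in> set v'" using less.prems(3) v last_in_set[OF False] by simp
      then obtain g t where t: "v' = g @ c # t" "c \<notin> set g" by (meson split_list_first)
      have "\<exists>gs. (\<forall>g \<in> set gs. c \<notin> set g) \<and> c # t = separated c gs"
        using less.prems v t by (intro less.hyps) auto
      then obtain gs where "\<forall>g \<in> set gs. c \<notin> set g" "c # t = separated c gs" by blast
      then show ?thesis using t v by (intro exI[of _ "g # gs"]) auto
    qed
  qed
  then show ?thesis using that by blast
qed

lemma sublist_separated:
  assumes "sublist gs hs"
  shows "sublist (separated c gs) (separated c hs)"
proof -
  obtain p s where "hs = p @ gs @ s" using assms by (auto simp: sublist_def)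
  then have "separated c hs = butlast (separated c p) @ separated c gs @ tl (separated c s)"
    by (simp add: separated_append'[of c p] separated_append[of c gs])
  then show ?thesis by (auto simp: sublist_def)
qed

lemma gap_sublist_separated:
  assumes "g \<in> set gs"
  shows "sublist (c # g @ [c]) (separated c gs)"
proof -
  have "sublist [g] gs" using assms by (auto simp: sublist_def in_set_conv_decomp)
  from sublist_separated[OF this, of c] show ?thesis by simp
qed

section \<open>The lexicographic order on gaps\<close>

text \<open>The appended \<open>c\<close> occurs in neither word, so neither extended word is a
  prefix of the other. Hence there is a first difference, which decides the comparison; one of the
  differing letters may be the final \<open>c\<close>.\<close>

lemma lexord_int_less_cases:
  assumes "X \<noteq> Y" "c \<notin> set X" "c \<notin> set Y"
  obtains t x y \<beta> \<beta>' where "X @ [c] = t @ x # \<beta>" "Y @ [c] = t @ y # \<beta>'" "x \<noteq> y"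
    "(X @ [c], Y @ [c]) \<in> lexord int_less \<longleftrightarrow> x < y"
proof -
  have "\<not> prefix (X @ [c]) (Y @ [c])" "\<not> prefix (Y @ [c]) (X @ [c])"
    using assms by (auto simp: prefix_snoc dest: set_mono_prefix)
  then have "X @ [c] \<parallel> Y @ [c]" by blast
  then obtain t x xs y ys where *: "x \<noteq> y" "X @ [c] = t @ x # xs" "Y @ [c] = t @ y # ys"
    by (blast dest: parallel_decomp)
  then have "(X @ [c], Y @ [c]) \<in> lexord int_less \<longleftrightarrow> x < y"
    by (simp add: lexord_same_pref_iff irrefl_def)
  with * that show ?thesis by blast
qed

text \<open>Since gaps are palindromes, the first letter at which two gaps differ is also the last one,
  so that the lexicographic order on gaps can be read from either side.\<close>

lemma order_reversing_gaps:
  fixes c :: int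
  assumes v: "order_reversing int_less (separated c gs)"
    and c: "\<forall>g \<in> set gs. c \<notin> set g" and pal: "\<forall>g \<in> set gs. rev g = g"
  shows "order_reversing {(X, Y). (X @ [c], Y @ [c]) \<in> lexord int_less} gs"
  unfolding order_reversing_def
proof (intro allI impI, elim conjE)
  fix X X' Y Y' U
  assume *: "sublist (X # U @ [Y]) gs" "sublist (X' # U @ [Y']) gs" "X \<noteq> X'" "Y \<noteq> Y'"
  have sub: "{X, Y, X', Y'} \<subseteq> set gs" using *(1,2) by (auto dest: set_mono_sublist)
  obtain s x x' \<alpha> \<alpha>' where X: "X @ [c] = s @ x # \<alpha>" "X' @ [c] = s @ x' # \<alpha>'" "x \<noteq> x'"
    "(X @ [c], X' @ [c]) \<in> lexord int_less \<longleftrightarrow> x < x'"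
    by (rule lexord_int_less_cases[OF *(3), of c]) (use c sub in auto)
  obtain t y y' \<beta> \<beta>' where Y: "Y' @ [c] = t @ y' # \<beta>'" "Y @ [c] = t @ y # \<beta>" "y' \<noteq> y"
    "(Y' @ [c], Y @ [c]) \<in> lexord int_less \<longleftrightarrow> y' < y"
    by (rule lexord_int_less_cases[OF *(4)[symmetric], of c]) (use c sub in auto)
  have "rev (X @ [c]) = c # X" "rev (X' @ [c]) = c # X'" using pal sub by auto
  then have X': "c # X = rev \<alpha> @ x # rev s" "c # X' = rev \<alpha>' @ x' # rev s"
    using X(1,2) by auto
  have eq: "separated c (Z # U @ [W]) = (c # Z) @ separated c U @ W @ [c]" for Z W
    by (simp add: separated_append)
  \<comment> \<open>With the left gaps aligned at their right ends, both factors read the same word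
    from the last difference of the left gaps to the first difference of the right gaps. It serves
    as the middle word.\<close>
  have "sublist (x # (rev s @ separated c U @ t) @ [y]) (separated c (X # U @ [Y]))"
    unfolding eq X' Y(2) by (auto simp: sublist_def)
  then have 1: "sublist (x # (rev s @ separated c U @ t) @ [y]) (separated c gs)"
    using sublist_separated[OF *(1)] sublist_order.order_trans by blast
  have "sublist (x' # (rev s @ separated c U @ t) @ [y']) (separated c (X' # U @ [Y']))"
    unfolding eq X' Y(1) by (auto simp: sublist_def)
  then have 2: "sublist (x' # (rev s @ separated c U @ t) @ [y']) (separated c gs)"
    using sublist_separated[OF *(2)] sublist_order.order_trans by blast
  from order_reversingD[OF v 1 2 X(3)] X(4) Y(3,4)
  show "((X, X') \<in> {(X, Y). (X @ [c], Y @ [c]) \<in> lexord int_less}) \<longleftrightarrow>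
    ((Y', Y) \<in> {(X, Y). (X @ [c], Y @ [c]) \<in> lexord int_less})"
    by auto
qed

text \<open>The order on gaps is strict and linear, so its ranks turn the recoded word into an
  integer word to which an induction hypothesis can apply.\<close>

lemma gap_code:
  fixes c :: int
  assumes "order_reversing int_less (separated c gs)"
    and "\<forall>g \<in> set gs. c \<notin> set g" "\<forall>g \<in> set gs. rev g = g"
  obtains f :: "int list \<Rightarrow> int"
  where "inj_on f (set gs)" "order_reversing int_less (map f gs)"
proof -
  let ?r = "{(X, Y). (X @ [c], Y @ [c]) \<in> lexord int_less}"
  have "trans (lexord int_less)" by (intro lexord_transI transI) auto
  then have "trans ?r" unfolding trans_def by blast
  moreover have "irrefl ?r"
    by (auto simp: irrefl_def lexord_irreflexive)
  moreover have "total_on (set gs) ?r"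
    unfolding total_on_def
    using lexord_linear[of int_less] by force
  ultimately have "strict_linear_order_on (set gs) ?r"
    by (simp add: strict_linear_order_on_def)
  from order_reversing_int_code[OF _ _ this order_reversing_gaps[OF assms]] that
  show ?thesis by auto
qed

section \<open>Full return words to a letter\<close>

lemma successive_letter_invariant:
  assumes "P a" "\<And>c c'. P c \<Longrightarrow> sublist [c, c'] (a # z) \<Longrightarrow> P c'"
  shows "\<forall>c \<in> set (a # z). P c"
  using assms
proof (induction z arbitrary: a)
  case (Cons d z)
  have "P d" using Cons.prems(1) by (rule Cons.prems(2)) (auto simp: sublist_Cons_right)
  then have "\<forall>c \<in> set (d # z). P c"
    using Cons.prems(2) by (intro Cons.IH) (auto simp: sublist_Cons_right)
  then show ?case using Cons.prems(1) by auto
qed auto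

text \<open>The letters in \<open>(x, a]\<close> are trapped: antitonicity against \<open>xa\<close> bounds the next letter by
  \<open>a\<close>, and antitonicity against \<open>bx\<close> keeps it above \<open>x\<close>.\<close>

lemma return_extremes_not_less:
  fixes x :: int
  assumes v: "order_reversing int_less (x # a # z @ [b, x])"
    and x: "x \<notin> set (a # z @ [b])" and "x < a"
  shows "b \<le> a"
proof (rule ccontr)
  assume "\<not> b \<le> a"
  let ?v = "x # a # z @ [b, x]"
  have xa: "sublist (x # [] @ [a]) ?v" by (auto simp: sublist_Cons_right)
  have bx: "sublist (b # [] @ [x]) ?v"
    unfolding sublist_def by (rule exI[of _ "x # a # z"]) auto
  have "\<forall>c \<in> set (a # (z @ [b])). x < c \<and> c \<le> a"
  proof (rule successive_letter_invariant)
    fix c c' assume c: "x < c \<and> c \<le> a" and cc: "sublist [c, c'] (a # z @ [b])"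
    have "sublist (a # z @ [b]) ?v"
      unfolding sublist_def by (rule exI[of _ "[x]"]) auto
    with cc have s: "sublist (c # [] @ [c']) ?v"
      using sublist_order.order_trans by fastforce
    have "c' \<noteq> x" using x set_mono_sublist[OF cc] by auto
    \<comment> \<open>As \<open>c \<le> a < b\<close>, comparing \<open>cc'\<close> with
      \<open>bx\<close> gives \<open>x < c'\<close>; comparing it with \<open>xa\<close> gives
      \<open>c' \<le> a\<close>.\<close>
    then show "x < c' \<and> c' \<le> a"
      using order_reversingD[OF v xa s] order_reversingD[OF v s bx] c \<open>\<not> b \<le> a\<close>
      by (cases "c' = a") auto
  qed (use \<open>x < a\<close> in auto)
  then show False using \<open>\<not> b \<le> a\<close> by auto
qed

text \<open>Reversal exchanges \<open>a\<close> and \<open>b\<close>, so the one-sided bound holds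
  both ways once \<open>x < b\<close>; this follows from comparing \<open>xa\<close> with
  \<open>bx\<close>.\<close>

lemma return_extremes_eq_above:
  fixes x :: int
  assumes v: "order_reversing int_less (x # a # z @ [b, x])"
    and x: "x \<notin> set (a # z @ [b])" and "x < a"
  shows "a = b"
proof (rule antisym)
  show "b \<le> a" by (rule return_extremes_not_less[OF assms])
  have xa: "sublist (x # [] @ [a]) (x # a # z @ [b, x])" by (auto simp: sublist_Cons_right)
  have bx: "sublist (b # [] @ [x]) (x # a # z @ [b, x])"
    unfolding sublist_def by (rule exI[of _ "x # a # z"]) auto
  have "x < b" using order_reversingD[OF v xa bx] x \<open>x < a\<close> by auto
  moreover have "order_reversing int_less (x # b # rev z @ [a, x])"
    using order_reversing_rev[OF v] by simp
  ultimately show "a \<le> b" using x by (intro return_extremes_not_less[of x b "rev z" a]) auto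
qed

text \<open>The case \<open>a < x\<close> reduces to \<open>x < a\<close> by negating all letters:
  the condition for an order is also the condition for its reverse.\<close>

lemma return_extremes_eq:
  fixes x :: int
  assumes v: "order_reversing int_less (x # a # z @ [b, x])"
    and x: "x \<notin> set (a # z @ [b])"
  shows "a = b"
proof (cases "x < a")
  case True
  then show ?thesis using return_extremes_eq_above assms by blast
next
  case False
  have "order_reversing {(i, j). j < i} (x # a # z @ [b, x])"
    unfolding order_reversing_def
    using order_reversingD[OF v] by (metis (mono_tags, lifting) case_prod_conv linorder_neqE mem_Collect_eq order_less_asym)
  then have "order_reversing int_less (map uminus (x # a # z @ [b, x]))"
    by (rule order_reversing_map) auto
  then have "- a = - b"
    using x False by (intro return_extremes_eq_above[of "- x" "- a" "map uminus z" "- b"]) auto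
  then show ?thesis by simp
qed

text \<open>Prolonging the return word by \<open>a\<close> on both sides turns the two letters
  \<open>x\<close> into gaps between letters \<open>a\<close>. No new comparison arises: all
  neighbours of \<open>x\<close> are \<open>a\<close>, so a middle word with differing letters on
  both sides neither begins nor ends with \<open>x\<close>, and its factors already occur in the
  shorter word.\<close>

lemma order_reversing_extend:
  assumes v: "order_reversing r (x # z @ [x])" and x: "x \<notin> set z"
    and z: "z \<noteq> []" "hd z = a" "last z = a"
  shows "order_reversing r (a # x # z @ [x, a])"
  unfolding order_reversing_def
proof (intro allI impI, elim conjE)
  let ?u = "a # x # z @ [x, a]"
  have "a \<noteq> x" using x z by auto
  \<comment> \<open>Stated for a general \<open>y\<close>, since the case of \<open>rev z\<close>
    yields the mirrored fact \<open>after\<close>.\<close>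
  have before: "d = a"
    if dx: "sublist [d, x] (a # x # y @ [x, a])" and y: "x \<notin> set y" "y \<noteq> []" "last y = a" for d y
  proof -
    obtain ps ss where "a # x # y @ [x, a] = ps @ [d, x] @ ss"
      using dx unfolding sublist_def by blast
    then have eq: "a # x # y @ [x, a] = ps @ d # x # ss" by simp
    show ?thesis
    proof (cases ps rule: list.exhaust[case_names Nil Cons])
      case Nil
      then show ?thesis using eq by simp
    next
      case (Cons p ps')
      then have "x # y @ [x, a] = ps' @ d # x # ss" using arg_cong[OF eq, of tl] by simp
      moreover have "hd (y @ [x, a]) \<noteq> x" using y by (cases y) auto
      ultimately obtain ps'' where 1: "y @ [x, a] = ps'' @ d # x # ss"
        by (cases ps') auto
      have "takeWhile (\<lambda>i. i \<noteq> x) (y @ [x, a]) = y" using y by (auto simp: takeWhile_append)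
      then have "y = takeWhile (\<lambda>i. i \<noteq> x) (ps'' @ d # x # ss)" using 1 by simp
      \<comment> \<open>The first \<open>x\<close> of \<open>y @ [x, a]\<close> directly follows
        \<open>y\<close>, and only \<open>a\<close> comes after it, so the \<open>x\<close> after
        \<open>d\<close> cannot be a later one.\<close>
      moreover have "x \<notin> set ps'' \<and> d \<noteq> x"
      proof (rule ccontr)
        assume "\<not> (x \<notin> set ps'' \<and> d \<noteq> x)"
        then have "x \<in> set (ps'' @ [d])" by auto
        then obtain q q' where "ps'' @ [d] = q @ x # q'" "x \<notin> set q" by (meson split_list_first)
        then have 2: "y @ [x, a] = q @ x # q' @ x # ss" using 1
          by (metis append.assoc append_Cons append_Nil)
        then have "takeWhile (\<lambda>i. i \<noteq> x) (y @ [x, a]) = q" using \<open>x \<notin> set q\<close>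
          by (auto simp: takeWhile_append)
        then have "y = q" using \<open>takeWhile _ (y @ [x, a]) = y\<close> by simp
        then show False using 2 \<open>a \<noteq> x\<close> by (auto simp: Cons_eq_append_conv)
      qed
      ultimately have "y = ps'' @ [d]" by (auto simp: takeWhile_append)
      then show ?thesis using y by simp
    qed
  qed
  have after: "d = a" if "sublist [x, d] ?u" for d
  proof -
    have "sublist (rev [x, d]) (rev ?u)" using that by (simp only: sublist_rev)
    then show ?thesis using before[of d "rev z"] x z by (simp add: last_rev)
  qed
  have inner: "sublist (d # u @ [e]) (x # z @ [x])"
    if s: "sublist (d # u @ [e]) ?u" and u: "u \<noteq> [] \<Longrightarrow> hd u \<noteq> x \<and> last u \<noteq> x" for d e u
  proof -
    obtain ps ss where eq: "?u = ps @ (d # u @ [e]) @ ss" using s by (auto simp: sublist_def)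
    show ?thesis
    proof (cases "u = []")
      case True
      obtain z1 where z1: "z = z1 @ [a]" using z by (metis append_butlast_last_id)
      obtain z2 where z2: "z = a # z2" using z by (metis list.collapse)
      have ax: "sublist [a, x] (x # z @ [x])"
        unfolding sublist_def z1 by (rule exI[of _ "x # z1"]) auto
      have xa: "sublist [x, a] (x # z @ [x])"
        unfolding z2 by (auto simp: sublist_Cons_right)
      show ?thesis
      proof (cases "ps = [] \<or> ss = []")
        case True
        then show ?thesis using eq \<open>u = []\<close> ax xa by auto
      next
        case False
        then obtain p ps' s ss' where "ps = p # ps'" "ss = ss' @ [s]"
          by (metis list.exhaust rev_exhaust)
        then have "x # z @ [x] = ps' @ (d # u @ [e]) @ ss'" using eq by auto
        then show ?thesis by (auto simp: sublist_def)
      qed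
    next
      case False
      then have "ps \<noteq> []" using eq u by (cases u) auto
      moreover have "ss \<noteq> []"
      proof
        assume "ss = []"
        then have "a # x # z @ [x] = ps @ d # u" using eq by auto
        then have "last (a # x # z @ [x]) = last (ps @ d # u)" by (rule arg_cong)
        then show False using False u by simp
      qed
      ultimately obtain p ps' s ss' where "ps = p # ps'" "ss = ss' @ [s]"
        by (metis list.exhaust rev_exhaust)
      then have "x # z @ [x] = ps' @ (d # u @ [e]) @ ss'" using eq by auto
      then show ?thesis by (auto simp: sublist_def)
    qed
  qed
  fix d d' e e' u
  assume *: "sublist (d # u @ [e]) ?u" "sublist (d' # u @ [e']) ?u" "d \<noteq> d'" "e \<noteq> e'"
  have u: "hd u \<noteq> x \<and> last u \<noteq> x" if ne: "u \<noteq> []"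
  proof -
    obtain u1 where u1: "u = hd u # u1" using ne by (metis list.collapse)
    obtain u2 where u2: "u = u2 @ [last u]" using ne by (metis append_butlast_last_id)
    have "sublist [i, hd u] (i # u @ [j])" for i j
      by (rule prefix_imp_sublist) (subst u1, simp)
    moreover have "sublist [last u, j] (i # u @ [j])" for i j
      unfolding sublist_def by (rule exI[of _ "i # u2"], rule exI[of _ "[]"]) (subst u2, simp)
    ultimately have "sublist [d, hd u] ?u" "sublist [d', hd u] ?u" "sublist [last u, e] ?u" "sublist [last u, e'] ?u"
      using *(1,2) sublist_order.order_trans by blast+
    then show ?thesis using before[of d z] before[of d' z] after[of e] after[of e'] x z *(3,4) by auto
  qed
  show "(d, d') \<in> r \<longleftrightarrow> (e', e) \<in> r"
    using order_reversingD[OF v inner[OF *(1) u] inner[OF *(2) u] *(3,4)] by blast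
qed

lemma letter_return_palindrome:
  fixes x :: int
  assumes "order_reversing int_less (x # z @ [x])" "x \<notin> set z"
  shows "rev z = z"
  using assms
proof (induction "length z" arbitrary: x z rule: less_induct)
  case less
  show ?case
  proof (cases "length z \<le> 1")
    case True
    then show ?thesis by (cases z) auto
  next
    case False
    then obtain a z' b where z: "z = a # z' @ [b]"
      by (cases z; cases "tl z" rule: rev_cases) auto
    then have "b = a" using return_extremes_eq[of x a z' b] less.prems by auto
    then have ends: "z \<noteq> []" "hd z = a" "last z = a" using z by auto
    then obtain gs where gs: "\<forall>g \<in> set gs. a \<notin> set g" "z = separated a gs"
      by (rule separated_exists)
    have "a \<noteq> x" using less.prems z by auto
    have gap: "sublist (a # g @ [a]) z" if "g \<in> set gs" for g
      using gap_sublist_separated[OF that] gs(2) by simp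
    have pal: "rev g = g" if "g \<in> set gs" for g
    proof (rule less.hyps)
      show "length g < length z" using sublist_length_le[OF gap[OF that]] by simp
      have "sublist z (x # z @ [x])" unfolding sublist_def by (rule exI[of _ "[x]"]) auto
      then show "order_reversing int_less (a # g @ [a])"
        using order_reversing_sublist[OF less.prems(1)] gap[OF that] sublist_order.order_trans by blast
      show "a \<notin> set g" using gs that by auto
    qed
    \<comment> \<open>The one-letter gaps \<open>[x]\<close> at both ends make the recoded word a
      return word to the code of \<open>[x]\<close>.\<close>
    let ?gs = "[x] # gs @ [[x]]"
    have "a # x # z @ [x, a] = separated a ?gs" using gs(2) by (simp add: separated_append)
    then have ord: "order_reversing int_less (separated a ?gs)"
      using order_reversing_extend[OF less.prems ends] by simp
    have cs: "\<forall>g \<in> set ?gs. a \<notin> set g" "\<forall>g \<in> set ?gs. rev g = g" using gs(1) pal \<open>a \<noteq> x\<close> by auto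
    obtain f :: "int list \<Rightarrow> int" where f: "inj_on f (set ?gs)" "order_reversing int_less (map f ?gs)"
      by (rule gap_code[OF ord cs])
    \<comment> \<open>The inner gaps lie in \<open>z\<close>, which avoids \<open>x\<close>.\<close>
    have notin: "[x] \<notin> set gs"
      using gap less.prems(2) set_mono_sublist by fastforce
    have "rev (map f gs) = map f gs"
    proof (rule less.hyps)
      show "length (map f gs) < length z" using gs(2) length_separated by simp
      show "order_reversing int_less (f [x] # map f gs @ [f [x]])" using f(2) by simp
      show "f [x] \<notin> set (map f gs)" using f(1) notin by (auto simp: inj_on_def)
    qed
    then have "map f (rev gs) = map f gs" by (simp add: rev_map)
    then have "rev gs = gs" by (rule map_inj_on) (use f(1) in \<open>auto simp: inj_on_def\<close>)
    then show ?thesis using separated_palindrome[of gs a] pal gs(2) by simp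
  qed
qed

section \<open>Full return words to a nonempty palindrome\<close>

text \<open>Having exactly two occurrences is expressed by \<open>w \<noteq> v\<close> and by every
  occurrence touching an end of \<open>v\<close>; this form carries over directly to recoded
  words.\<close>

lemma return_palindrome:
  fixes v w :: "int list"
  assumes "order_reversing int_less v" "rev w = w" "w \<noteq> []" "w \<noteq> v" "prefix w v" "suffix w v"
    and "\<And>p s. v = p @ w @ s \<Longrightarrow> p = [] \<or> s = []"
  shows "rev v = v"
  using assms
proof (induction "length v" arbitrary: v w rule: less_induct)
  case less
  obtain s0 where s0: "v = w @ s0" using less.prems(5) by (auto simp: prefix_def)
  obtain q0 where q0: "v = q0 @ w" using less.prems(6) by (auto simp: suffix_def)
  have ne: "s0 \<noteq> []" "q0 \<noteq> []" using less.prems(4) s0 q0 by auto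
  define c where "c = hd w"
  have hw: "hd w = c" "last w = c"
    using less.prems(2,3) by (auto simp: c_def) (metis hd_rev)
  have "last s0 = c" using hw less.prems(3) s0 q0 ne by (metis last_appendR)
  have "hd q0 = c" using hw less.prems(3) s0 q0 ne by (metis hd_append2)
  obtain W where W: "\<forall>g \<in> set W. c \<notin> set g" "w = separated c W"
    using separated_exists[OF less.prems(3) hw] .
  \<comment> \<open>The last letter of \<open>w\<close> is put in front of \<open>s0\<close>, so
    that the remainder also has a \<open>c\<close> at both ends.\<close>
  obtain S where S: "\<forall>g \<in> set S. c \<notin> set g" "c # s0 = separated c S"
    using separated_exists[of "c # s0" c] \<open>last s0 = c\<close> ne by auto
  obtain Q where Q: "\<forall>g \<in> set Q. c \<notin> set g" "q0 @ [c] = separated c Q"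
    using separated_exists[of "q0 @ [c]" c] \<open>hd q0 = c\<close> ne by auto
  have v: "v = separated c (W @ S)"
    using s0 W(2) S(2) by (simp add: separated_append) (metis list.sel(3))
  have v': "v = separated c (Q @ W)"
    using q0 W(2) Q(2) by (simp add: separated_append') (metis butlast_snoc)
  \<comment> \<open>Uniqueness of the gaps makes the gap list of \<open>w\<close> both a prefix and
    a suffix of that of \<open>v\<close>.\<close>
  have eq: "W @ S = Q @ W"
    using v v' W(1) S(1) Q(1) by (intro separated_inj[of _ c]) auto
  have "S \<noteq> []" using S(2) ne by auto
  have pal: "rev g = g" if "g \<in> set (W @ S)" for g
  proof (rule letter_return_palindrome)
    show "order_reversing int_less (c # g @ [c])"
      using order_reversing_sublist[OF less.prems(1)] gap_sublist_separated[OF that] v by simp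
    show "c \<notin> set g" using that W(1) S(1) by auto
  qed
  have "rev (W @ S) = W @ S"
  proof (cases "W = []")
    \<comment> \<open>Here \<open>w = [c]\<close>, and a second gap would produce an inner
      occurrence of \<open>c\<close>.\<close>
    case True
    have "length S = 1"
    proof (rule ccontr)
      assume "length S \<noteq> 1"
      then obtain g h S' where "S = g # h # S'" using \<open>S \<noteq> []\<close>
        by (metis One_nat_def length_0_conv length_Cons list.exhaust)
      then have "v = (c # g) @ [c] @ (h @ separated c S')" using v True by simp
      then show False using less.prems(7)[of "c # g" "h @ separated c S'"] W(2) True by simp
    qed
    then show ?thesis using True by (cases S) auto
  next
    case False
    have "order_reversing int_less (separated c (W @ S))" using less.prems(1) v by simp
    then obtain f :: "int list \<Rightarrow> int"
      where f: "inj_on f (set (W @ S))" "order_reversing int_less (map f (W @ S))"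
      by (rule gap_code) (use W(1) S(1) pal in auto)
    \<comment> \<open>Reversing \<open>w\<close> reverses the gap list and each gap. The gaps are
      palindromes, so the gap list itself is one.\<close>
    have "separated c (rev (map rev W)) = separated c W"
      using less.prems(2) W(2) by (simp add: rev_separated)
    moreover have "map rev W = W" using pal by (simp add: map_idI)
    ultimately have "rev W = W" using W(1) by (intro separated_inj[of _ c]) auto
    have "rev (map f (W @ S)) = map f (W @ S)"
    proof (rule less.hyps[of _ "map f W"])
      show "length (map f (W @ S)) < length v" using v length_separated[of "W @ S" c] by simp
      show "order_reversing int_less (map f (W @ S))" by (rule f(2))
      show "rev (map f W) = map f W" using \<open>rev W = W\<close> by (simp add: rev_map)
      show "map f W \<noteq> []" "map f W \<noteq> map f (W @ S)" using False \<open>S \<noteq> []\<close> by auto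
      show "prefix (map f W) (map f (W @ S))" by simp
      show "suffix (map f W) (map f (W @ S))" unfolding eq by (simp add: suffix_def)
    next
      fix p s assume "map f (W @ S) = p @ map f W @ s"
      then obtain P W' T where PT: "W @ S = P @ W' @ T" "p = map f P" "map f W = map f W'" "s = map f T"
        by (elim map_eq_append3E)
      \<comment> \<open>The code is injective on gaps, so an occurrence of the coded list is one of
        \<open>W\<close>, and expanding it gives an occurrence of \<open>w\<close> in
        \<open>v\<close>.\<close>
      have "W' = W"
      proof (rule map_inj_on)
        show "map f W' = map f W" using PT(3) by simp
        have "set W' \<subseteq> set (W @ S)" unfolding PT(1) by auto
        then show "inj_on f (set W' \<union> set W)" by (intro inj_on_subset[OF f(1)]) auto
      qed
      then have "v = butlast (separated c P) @ w @ tl (separated c T)"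
        using v PT(1) W(2) by (simp add: separated_append' [of c P] separated_append[of c W])
      then have "butlast (separated c P) = [] \<or> tl (separated c T) = []" by (rule less.prems(7))
      then have "P = [] \<or> T = []"
        by (cases P; cases T) (auto simp: butlast_append)
      then show "p = [] \<or> s = []" using PT by auto
    qed
    then have "map f (rev (W @ S)) = map f (W @ S)" by (simp only: rev_map)
    then show ?thesis by (rule map_inj_on) (use f(1) in \<open>auto simp: inj_on_def\<close>)
  qed
  then show ?case using separated_palindrome[of "W @ S" c] pal v by auto
qed

section \<open>From languages to single words\<close>

text \<open>Two factors with the same middle word and different letters on both sides make that
  middle word bispecial, so the order condition applies to it.\<close>

lemma language_order_reversing:
  assumes L: "language A L" and sym: "symmetric_order_condition A L rA rD" and v: "v \<in> L"
  shows "order_reversing rA v"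
  unfolding order_reversing_def
proof (intro allI impI, elim conjE)
  fix x x' y y' u
  assume *: "sublist (x # u @ [y]) v" "sublist (x' # u @ [y']) v" "x \<noteq> x'" "y \<noteq> y'"
  have closed: "t \<in> L" if "sublist t s" "s \<in> L" for s t
    using L that unfolding language_def by blast
  have in_L: "x # u @ [y] \<in> L" "x' # u @ [y'] \<in> L" using closed * v by blast+
  have parts: "sublist (i # u) (i # u @ [j])" "sublist (u @ [j]) (i # u @ [j])"
    "sublist u (i # u @ [j])" for i j :: 'a
  proof -
    show "sublist (i # u) (i # u @ [j])" by (rule prefix_imp_sublist) auto
    show "sublist (u @ [j]) (i # u @ [j])" by (rule suffix_imp_sublist) (auto simp: suffix_def)
    show "sublist u (i # u @ [j])" unfolding sublist_def by (rule exI[of _ "[i]"]) auto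
  qed
  have "bispecial L u"
    unfolding bispecial_def using closed[OF parts(1)] closed[OF parts(2)] closed[OF parts(3)] in_L *(3,4)
    by blast
  then have "word_order_condition L rA (rA\<inverse>) u"
    using sym unfolding symmetric_order_condition_def order_condition_def by auto
  then show "(x, x') \<in> rA \<longleftrightarrow> (y', y) \<in> rA"
    using in_L *(3,4) unfolding word_order_condition_def by blast
qed

text \<open>The prefix and suffix positions of \<open>w\<close> are distinct once
  \<open>w \<noteq> v\<close>, so they exhaust the two occurrences.\<close>

lemma full_return_word_occurrence:
  assumes "full_return_word L w v" "v = p @ w @ s"
  shows "w \<noteq> v" and "p = [] \<or> s = []"
proof -
  have card: "card (occurrences w v) = 2" and pre: "prefix w v" and suf: "suffix w v"
    using assms(1) by (auto simp: full_return_word_def)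
  show "w \<noteq> v"
  proof
    assume "w = v"
    then have "occurrences w v = {0}"
      unfolding occurrences_def by (auto dest: arg_cong[where f = length])
    then show False using card by simp
  qed
  let ?n = "length v - length w"
  have "0 \<in> occurrences w v" using pre by (auto simp: occurrences_def prefix_def)
  moreover have "?n \<in> occurrences w v" using suf by (fastforce simp: occurrences_def suffix_def)
  moreover have "?n \<noteq> 0" using pre \<open>w \<noteq> v\<close> by (auto simp: prefix_def)
  moreover have "finite (occurrences w v)" using card by (intro card_ge_0_finite) auto
  ultimately have "occurrences w v = {0, ?n}"
    using card by (intro card_subset_eq[symmetric]) auto
  moreover have "length p \<in> occurrences w v" using assms(2) by (auto simp: occurrences_def)
  ultimately show "p = [] \<or> s = []" using assms(2) by auto
qed

text \<open>The empty word occurs at every position, the end included, hence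
  \<open>length v + 1\<close> times.\<close>

lemma full_return_word_Nil:
  assumes "full_return_word L [] v"
  shows "length v = 1"
proof -
  have "occurrences [] v = {..length v}"
    unfolding occurrences_def by auto (metis append_take_drop_id length_take min.absorb2)
  then show ?thesis using assms by (simp add: full_return_word_def)
qed

theorem theorem3:
  fixes A :: "'a set" and L :: "'a list set" and rA rD :: "'a rel"
  assumes "finite A"
    and "language A L"
    and "symmetric_order_condition A L rA rD"
  shows "rich L"
  unfolding rich_def
proof (intro allI impI, elim conjE)
  fix w v assume w: "palindrome w" and ret: "full_return_word L w v"
  have v: "v \<in> L" and pre: "prefix w v" and suf: "suffix w v"
    using ret by (auto simp: full_return_word_def)
  show "palindrome v"
  proof (cases "w = []")
    \<comment> \<open>The empty palindrome has no first letter to cut at, so it is settled by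
      counting.\<close>
    case True
    then have "length v = 1" using full_return_word_Nil ret by blast
    then show ?thesis by (cases v) (auto simp: palindrome_def)
  next
    case False
    have "set v \<subseteq> A" using assms(2) v by (auto simp: language_def)
    moreover have "strict_linear_order_on A rA"
      using assms(3)
      by (auto simp: symmetric_order_condition_def order_condition_def strict_total_order_on_def)
    ultimately obtain f :: "'a \<Rightarrow> int"
      where f: "inj_on f A" "order_reversing int_less (map f v)"
      using order_reversing_int_code[OF assms(1)] language_order_reversing[OF assms(2,3) v] by blast
    have inj: "inj_on f (set v)" using inj_on_subset[OF f(1) \<open>set v \<subseteq> A\<close>] .
    have "set w \<subseteq> set v" using pre by (auto simp: prefix_def)
    obtain s0 where s0: "v = w @ s0" using pre by (auto simp: prefix_def)
    have "s0 \<noteq> []" using full_return_word_occurrence(1)[OF ret, of "[]" s0] s0 by auto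
    have "rev (map f v) = map f v"
    proof (rule return_palindrome[OF f(2), of "map f w"])
      show "rev (map f w) = map f w" using w by (simp add: palindrome_def rev_map)
      show "map f w \<noteq> []" "map f w \<noteq> map f v" using False s0 \<open>s0 \<noteq> []\<close> by auto
      show "prefix (map f w) (map f v)" using s0 by simp
      show "suffix (map f w) (map f v)" using suf by (auto simp: suffix_def)
    next
      fix p s assume "map f v = p @ map f w @ s"
      then obtain p' w' s' where d: "v = p' @ w' @ s'" "p = map f p'" "map f w = map f w'" "s = map f s'"
        by (elim map_eq_append3E)
      have "w' = w"
      proof (rule map_inj_on)
        show "map f w' = map f w" using d(3) by simp
        show "inj_on f (set w' \<union> set w)"
          using \<open>set w \<subseteq> set v\<close> d(1) by (intro inj_on_subset[OF inj]) auto
      qed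
      then show "p = [] \<or> s = []" using full_return_word_occurrence(2)[OF ret] d by blast
    qed
    then have "map f (rev v) = map f v" by (simp add: rev_map)
    then show ?thesis unfolding palindrome_def by (rule map_inj_on) (use inj in auto)
  qed
qed

end
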